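(* Let $\theta>0$ and $0\le\alpha<1$. Let $s^*_{UD_n}(r)$ be the maximal separation distance after $r$ iterations of the down-up chain with parameters $\theta,\alpha$ on the $n$th level of the Kingman lattice, and let $s^*_{DU_n}(r)$ be the corresponding quantity for the up-down chain on the $n$th level. Then $$s^*_{DU_n}(r)=s^*_{UD_{n+1}}(r+1)$$ for all $n\ge1$, $r\ge0$.
   Context: For a partition $\lambda$, $m_k(\lambda)$ is the number of parts (rows) of size $k$ and $l(\lambda)$ the number of parts. Down chain: from a partition $\lambda$ of $n$, for each $j\ge1$ with $m_j(\lambda)>0$, remove a box from a row of length $j$ (replace a part $j$ by $j-1$) with probability $\frac{j\,m_j(\lambda)}{n}$, obtaining a partition of $n-1$. Up chain: from a partition $\lambda$ of $n$, for each $k\ge1$ add a box to a row of length $k$ (replace a part $k$ by $k+1$) with probability $\frac{(k-\alpha)m_k(\lambda)}{\theta+n}$, and add a new part of size $1$ with probability $\frac{\theta+\alpha l(\lambda)}{\theta+n}$, obtaining a partition of $n+1$. The down-up chain on the $n$th level of the Kingman lattice is the Markov chain on partitions of $n$ taking one down step (to a partition of $n-1$) and then one up step; the up-down chain on the $n$th level takes one up step (to a partition of $n+1$) and then one down step. Both have as stationary distribution the Pitman distribution $$\pi(\lambda)=\frac{\theta(\theta+\alpha)\cdots(\theta+(l(\lambda)-1)\alpha)}{\theta(\theta+1)\cdots(\theta+n-1)}\,\frac{n!}{\prod_k m_k(\lambda)!\prod_{i=1}^{l(\lambda)}\lambda_i!}\prod_{(i,j)\in\lambda,\ j\ge2}(j-1-\alpha),$$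 the last product being over boxes $(i,j)$ (row $i$, column $j$) of the diagram of $\lambda$. For a Markov chain $K$ on a finite set with stationary distribution $\pi$, the maximal separation distance is $s^*(r)=\max_{x,y}\left[1-\frac{K^r(x,y)}{\pi(y)}\right]$. *)

theory Defs
  imports Complex_Main "HOL-Library.Multiset"
begin

section \<open>Partitions\<close>

text \<open>A partition is the multiset of its parts (rows), all of which are positive:
  \<open>m\<^sub>k(\<mu>)\<close> is \<^term>\<open>count \<mu> k\<close> and \<open>l(\<mu>)\<close> is \<^term>\<open>size \<mu>\<close>.
  The only partition of 0 is \<^term>\<open>{#}\<close>.\<close>

definition partitions :: "nat \<Rightarrow> nat multiset set" where
  "partitions n = {\<mu>. 0 \<notin># \<mu> \<and> sum_mset \<mu> = n}"

definition remove_box :: "nat \<Rightarrow> nat multiset \<Rightarrow> nat multiset" where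
  "remove_box j \<mu> = (if j = 1 then \<mu> - {#1#} else add_mset (j - 1) (\<mu> - {#j#}))"

definition add_box :: "nat \<Rightarrow> nat multiset \<Rightarrow> nat multiset" where
  "add_box k \<mu> = add_mset (k + 1) (\<mu> - {#k#})"

section \<open>The down and up chains\<close>

definition down_step :: "nat multiset \<Rightarrow> nat multiset \<Rightarrow> real" where
  "down_step \<mu> \<nu> =
     (\<Sum>j\<in>set_mset \<mu>. if \<nu> = remove_box j \<mu>
        then real j * real (count \<mu> j) / real (sum_mset \<mu>) else 0)"

definition up_step :: "real \<Rightarrow> real \<Rightarrow> nat multiset \<Rightarrow> nat multiset \<Rightarrow> real" where
  "up_step \<theta> \<alpha> \<mu> \<nu> =
     (\<Sum>k\<in>set_mset \<mu>. if \<nu> = add_box k \<mu>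
        then (real k - \<alpha>) * real (count \<mu> k) / (\<theta> + real (sum_mset \<mu>)) else 0)
     + (if \<nu> = add_mset 1 \<mu>
        then (\<theta> + \<alpha> * real (size \<mu>)) / (\<theta> + real (sum_mset \<mu>)) else 0)"

definition down_up_chain :: "real \<Rightarrow> real \<Rightarrow> nat \<Rightarrow> nat multiset \<Rightarrow> nat multiset \<Rightarrow> real" where
  "down_up_chain \<theta> \<alpha> n \<mu> \<rho> =
     (\<Sum>\<nu>\<in>partitions (n - 1). down_step \<mu> \<nu> * up_step \<theta> \<alpha> \<nu> \<rho>)"

definition up_down_chain :: "real \<Rightarrow> real \<Rightarrow> nat \<Rightarrow> nat multiset \<Rightarrow> nat multiset \<Rightarrow> real" where
  "up_down_chain \<theta> \<alpha> n \<mu> \<rho> =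
     (\<Sum>\<nu>\<in>partitions (n + 1). up_step \<theta> \<alpha> \<mu> \<nu> * down_step \<nu> \<rho>)"

text \<open>The common stationary distribution of both chains on each level. The last factor
  runs over the boxes outside the first column: a row of size \<open>p\<close> contributes the
  columns \<open>2, \<dots>, p\<close>.\<close>

definition pitman :: "real \<Rightarrow> real \<Rightarrow> nat multiset \<Rightarrow> real" where
  "pitman \<theta> \<alpha> \<mu> =
     (\<Prod>i<size \<mu>. \<theta> + real i * \<alpha>) / pochhammer \<theta> (sum_mset \<mu>)
     * (fact (sum_mset \<mu>)
        / ((\<Prod>k\<in>set_mset \<mu>. fact (count \<mu> k)) * (\<Prod>p\<in>#\<mu>. fact p)))
     * (\<Prod>p\<in>#\<mu>. \<Prod>j=2..p. real j - 1 - \<alpha>)"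

section \<open>Maximal separation distance\<close>

text \<open>A chain on a finite set \<open>S\<close> is given by its transition matrix \<open>K\<close>, of which only the
  entries indexed by \<open>S \<times> S\<close> matter.\<close>

fun iterate_kernel :: "'s set \<Rightarrow> ('s \<Rightarrow> 's \<Rightarrow> real) \<Rightarrow> nat \<Rightarrow> 's \<Rightarrow> 's \<Rightarrow> real" where
  "iterate_kernel S K 0 x y = (if x = y then 1 else 0)"
| "iterate_kernel S K (Suc r) x y = (\<Sum>z\<in>S. iterate_kernel S K r x z * K z y)"

definition max_separation ::
  "'s set \<Rightarrow> ('s \<Rightarrow> 's \<Rightarrow> real) \<Rightarrow> ('s \<Rightarrow> real) \<Rightarrow> nat \<Rightarrow> real" where
  "max_separation S K \<pi> r =
     Max ((\<lambda>(x, y). 1 - iterate_kernel S K r x y / \<pi> y) ` (S \<times> S))"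

definition sep_down_up :: "real \<Rightarrow> real \<Rightarrow> nat \<Rightarrow> nat \<Rightarrow> real" where
  "sep_down_up \<theta> \<alpha> n r =
     max_separation (partitions n) (down_up_chain \<theta> \<alpha> n) (pitman \<theta> \<alpha>) r"

definition sep_up_down :: "real \<Rightarrow> real \<Rightarrow> nat \<Rightarrow> nat \<Rightarrow> real" where
  "sep_up_down \<theta> \<alpha> n r =
     max_separation (partitions n) (up_down_chain \<theta> \<alpha> n) (pitman \<theta> \<alpha>) r"

section \<open>Well-formedness\<close>

lemma size_le_sum_mset: "0 \<notin># \<mu> \<Longrightarrow> size \<mu> \<le> sum_mset (\<mu> :: nat multiset)"
  by (induction \<mu>) auto

lemma finite_partitions: "finite (partitions n)"
proof (rule finite_subset)
  show "partitions n \<subseteq> mset ` {xs. set xs \<subseteq> {..n} \<and> length xs \<le> n}"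
  proof
    fix \<mu> assume \<mu>: "\<mu> \<in> partitions n"
    obtain xs where xs: "\<mu> = mset xs" by (metis ex_mset)
    have "set xs \<subseteq> {..n}"
      using \<mu> xs by (auto simp: partitions_def sum_mset_sum_list intro: member_le_sum_list)
    moreover have "length xs \<le> n"
      using \<mu> xs size_le_sum_mset[of \<mu>] by (auto simp: partitions_def)
    ultimately show "\<mu> \<in> mset ` {xs. set xs \<subseteq> {..n} \<and> length xs \<le> n}" using xs by blast
  qed
  show "finite (mset ` {xs. set xs \<subseteq> {..n} \<and> length xs \<le> n})"
    by (intro finite_imageI finite_lists_length_le) simp
qed

lemma partitions_nonempty: "partitions n \<noteq> {}"
proof -
  have "replicate_mset n 1 \<in> partitions n" by (auto simp: partitions_def)
  then show ?thesis by blast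
qed

lemma remove_box_in_partitions:
  assumes "\<mu> \<in> partitions n" "j \<in># \<mu>"
  shows "remove_box j \<mu> \<in> partitions (n - 1)"
proof -
  obtain \<kappa> where "\<mu> = add_mset j \<kappa>" using assms(2) by (metis mset_add)
  then show ?thesis using assms by (auto simp: partitions_def remove_box_def)
qed

lemma add_box_in_partitions:
  assumes "\<mu> \<in> partitions n" "k \<in># \<mu>"
  shows "add_box k \<mu> \<in> partitions (n + 1)"
proof -
  obtain \<kappa> where "\<mu> = add_mset k \<kappa>" using assms(2) by (metis mset_add)
  then show ?thesis using assms by (auto simp: partitions_def add_box_def)
qed

lemma sum_parts: "(\<Sum>k\<in>set_mset \<mu>. real k * real (count \<mu> k)) = real (sum_mset \<mu>)"
proof -
  obtain xs where xs: "\<mu> = mset xs" by (metis ex_mset)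
  have "sum_mset \<mu> = (\<Sum>k\<in>set_mset \<mu>. k * count \<mu> k)"
    using sum_list_map_eq_sum_count[of id xs]
    by (simp add: xs sum_mset_sum_list count_mset mult.commute)
  then show ?thesis by (simp flip: of_nat_mult of_nat_sum)
qed

lemma down_step_sum:
  assumes "\<mu> \<in> partitions n" "n \<ge> 1"
  shows "(\<Sum>\<nu>\<in>partitions (n - 1). down_step \<mu> \<nu>) = 1"
proof -
  have "(\<Sum>\<nu>\<in>partitions (n - 1). down_step \<mu> \<nu>) =
      (\<Sum>j\<in>set_mset \<mu>. \<Sum>\<nu>\<in>partitions (n - 1). if \<nu> = remove_box j \<mu>
         then real j * real (count \<mu> j) / real (sum_mset \<mu>) else 0)"
    unfolding down_step_def by (rule sum.swap)
  also have "\<dots> = (\<Sum>j\<in>set_mset \<mu>. real j * real (count \<mu> j) / real (sum_mset \<mu>))"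
    using remove_box_in_partitions[OF assms(1)]
    by (intro sum.cong) (auto simp: sum.delta finite_partitions)
  also have "\<dots> = 1"
    using assms by (simp add: sum_parts partitions_def flip: sum_divide_distrib)
  finally show ?thesis .
qed

lemma up_step_sum:
  assumes "\<mu> \<in> partitions n" "\<theta> > 0"
  shows "(\<Sum>\<nu>\<in>partitions (n + 1). up_step \<theta> \<alpha> \<mu> \<nu>) = 1"
proof -
  let ?w = "\<lambda>k. (real k - \<alpha>) * real (count \<mu> k)"
  let ?d = "\<theta> + real (sum_mset \<mu>)"
  have new: "add_mset 1 \<mu> \<in> partitions (n + 1)" using assms by (auto simp: partitions_def)
  have w: "(\<Sum>k\<in>set_mset \<mu>. ?w k) = real (sum_mset \<mu>) - \<alpha> * real (size \<mu>)"
    by (simp add: left_diff_distrib sum_subtractf sum_parts size_multiset_overloaded_eq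
        flip: sum_distrib_left)
  have "(\<Sum>\<nu>\<in>partitions (n + 1). up_step \<theta> \<alpha> \<mu> \<nu>) =
      (\<Sum>k\<in>set_mset \<mu>. \<Sum>\<nu>\<in>partitions (n + 1). if \<nu> = add_box k \<mu> then ?w k / ?d else 0)
      + (\<theta> + \<alpha> * real (size \<mu>)) / ?d"
    unfolding up_step_def sum.distrib using new
    by (subst sum.swap) (simp add: sum.delta finite_partitions)
  also have "(\<Sum>k\<in>set_mset \<mu>. \<Sum>\<nu>\<in>partitions (n + 1). if \<nu> = add_box k \<mu> then ?w k / ?d else 0)
      = (\<Sum>k\<in>set_mset \<mu>. ?w k / ?d)"
    using add_box_in_partitions[OF assms(1)]
    by (intro sum.cong) (auto simp: sum.delta finite_partitions)
  also have "\<dots> = (real (sum_mset \<mu>) - \<alpha> * real (size \<mu>)) / ?d"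
    by (simp add: w flip: sum_divide_distrib)
  finally have "(\<Sum>\<nu>\<in>partitions (n + 1). up_step \<theta> \<alpha> \<mu> \<nu>) = ?d / ?d"
    by (simp only: flip: add_divide_distrib) simp
  moreover have "?d \<noteq> 0" using assms(2) by (simp add: add_pos_nonneg del: of_nat_sum_mset)
  ultimately show ?thesis by simp
qed

end

theory Submission
  imports Defs
begin

text \<open>Let \<open>U\<close> and \<open>D\<close> be the up and down transition matrices, \<open>K = UD\<close> the up-down chain on
  level \<open>n\<close> and \<open>Q = DU\<close> the down-up chain on level \<open>n + 1\<close>. Since \<open>Q\<^sup>r\<^sup>+\<^sup>1 = D K\<^sup>r U\<close> and \<open>U\<close>, \<open>D\<close>
  are adjoint with respect to \<open>\<pi>\<close>, the ratio \<open>Q\<^sup>r\<^sup>+\<^sup>1(x, y) / \<pi>(y)\<close> is the average of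
  \<open>K\<^sup>r(a, b) / \<pi>(b)\<close> over independent down steps \<open>a\<close> from \<open>x\<close> and \<open>b\<close> from \<open>y\<close>. Hence its
  minimum is at least that of \<open>K\<^sup>r(a, b) / \<pi>(b)\<close>. The one-row and the one-column partitions have
  deterministic down steps, to the partitions of the same shape, so equality holds provided
  \<open>K\<^sup>r(a, b) / \<pi>(b)\<close> is minimal at \<open>a = (n)\<close>, \<open>b = (1\<^sup>n)\<close>. This follows by induction on \<open>n\<close>:
  the commutation relation writes \<open>UD\<close> on level \<open>n\<close> as a combination of \<open>DU\<close> on level \<open>n\<close> and
  the identity with nonnegative coefficients, so \<open>K\<^sup>r\<close> is a nonnegative combination of powers of
  \<open>DU\<close>, to each of which the averaging argument applies one level below.\<close>

section \<open>Sums and products over multisets\<close>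

text \<open>The transition probabilities are defined through distinct sizes and multiplicities. This
  passes to sums over single rows, which split cleanly at a chosen row.\<close>

lemma sum_count_eq_sum_mset:
  fixes g :: "'a \<Rightarrow> real"
  shows "(\<Sum>k\<in>set_mset M. g k * real (count M k)) = (\<Sum>k\<in>#M. g k)"
proof (induction M)
  case (add a M)
  have "(\<Sum>k\<in>set_mset (add_mset a M). g k * real (count (add_mset a M) k))
      = (\<Sum>k\<in>insert a (set_mset M). g k * real (count M k) + (if k = a then g a else 0))"
    by (intro sum.cong) (auto simp: algebra_simps)
  also have "\<dots> = (\<Sum>k\<in>insert a (set_mset M). g k * real (count M k)) + g a"
    by (simp add: sum.distrib)
  also have "(\<Sum>k\<in>insert a (set_mset M). g k * real (count M k))
      = (\<Sum>k\<in>set_mset M. g k * real (count M k))"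
    by (rule sum.mono_neutral_right) (auto simp: count_eq_zero_iff)
  finally show ?case using add.IH by simp
qed simp

lemma prod_fact_count_add_mset:
  "(\<Prod>k\<in>set_mset (add_mset a M). fact (count (add_mset a M) k) :: real)
     = real (count M a + 1) * (\<Prod>k\<in>set_mset M. fact (count M k))"
proof -
  have "(\<Prod>k\<in>set_mset (add_mset a M). fact (count (add_mset a M) k) :: real)
      = (\<Prod>k\<in>insert a (set_mset M). fact (count M k) * (if k = a then real (count M a + 1) else 1))"
    by (intro prod.cong) auto
  also have "\<dots> = (\<Prod>k\<in>insert a (set_mset M). fact (count M k)) * real (count M a + 1)"
    by (simp add: prod.distrib)
  also have "(\<Prod>k\<in>insert a (set_mset M). fact (count M k) :: real)
      = (\<Prod>k\<in>set_mset M. fact (count M k))"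
    by (rule prod.mono_neutral_right) (auto simp: not_in_iff)
  finally show ?thesis by simp
qed

lemma sum_mset_diff:
  fixes f g :: "'a \<Rightarrow> real"
  shows "(\<Sum>k\<in>#M. f k - g k) = (\<Sum>k\<in>#M. f k) - (\<Sum>k\<in>#M. g k)"
  by (induction M) auto

text \<open>Both sides run over ordered pairs of different rows. The inner range depends on the
  outer row, so the diagonal is split off from the full double sum, which can be swapped.\<close>

lemma sum_mset_pairs_swap:
  fixes F :: "'a \<Rightarrow> 'a \<Rightarrow> real"
  shows "(\<Sum>k\<in>#M. \<Sum>j\<in>#M - {#k#}. F k j) = (\<Sum>j\<in>#M. \<Sum>k\<in>#M - {#j#}. F k j)"
proof -
  have diff: "(\<Sum>j\<in>#M - {#k#}. G j) = (\<Sum>j\<in>#M. G j) - G k"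
    if "k \<in># M" for k and G :: "'a \<Rightarrow> real"
    using that by (auto dest!: multi_member_split)
  have "(\<Sum>k\<in>#M. \<Sum>j\<in>#M - {#k#}. F k j) = (\<Sum>k\<in>#M. (\<Sum>j\<in>#M. F k j) - F k k)"
    by (intro arg_cong[where f = sum_mset] image_mset_cong) (simp add: diff)
  also have "\<dots> = (\<Sum>k\<in>#M. \<Sum>j\<in>#M. F k j) - (\<Sum>k\<in>#M. F k k)"
    by (rule sum_mset_diff)
  also have "(\<Sum>k\<in>#M. \<Sum>j\<in>#M. F k j) = (\<Sum>j\<in>#M. \<Sum>k\<in>#M. F k j)"
    by (rule sum_mset.swap)
  also have "(\<Sum>j\<in>#M. \<Sum>k\<in>#M. F k j) - (\<Sum>k\<in>#M. F k k)
      = (\<Sum>j\<in>#M. (\<Sum>k\<in>#M. F k j) - F j j)"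
    by (rule sum_mset_diff[symmetric])
  also have "\<dots> = (\<Sum>j\<in>#M. \<Sum>k\<in>#M - {#j#}. F k j)"
    by (intro arg_cong[where f = sum_mset] image_mset_cong) (simp add: diff)
  finally show ?thesis .
qed

section \<open>One-step expectations\<close>

lemma down_step_eq:
  "down_step \<mu> \<nu> = (\<Sum>j\<in>#\<mu>. real j * of_bool (\<nu> = remove_box j \<mu>)) / real (sum_mset \<mu>)"
  unfolding down_step_def sum_count_eq_sum_mset[symmetric] sum_divide_distrib
  by (intro sum.cong) auto

lemma up_step_eq:
  "up_step \<theta> \<alpha> \<mu> \<nu> =
     ((\<Sum>k\<in>#\<mu>. (real k - \<alpha>) * of_bool (\<nu> = add_box k \<mu>))
      + (\<theta> + \<alpha> * real (size \<mu>)) * of_bool (\<nu> = add_mset 1 \<mu>)) / (\<theta> + real (sum_mset \<mu>))"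
  unfolding up_step_def sum_count_eq_sum_mset[symmetric] add_divide_distrib sum_divide_distrib
  by (intro arg_cong2[where f = "(+)"] sum.cong)
     (auto simp: add_divide_distrib simp del: of_nat_sum_mset)

lemma down_step_expectation:
  assumes "\<mu> \<in> partitions n"
  shows "(\<Sum>\<nu>\<in>partitions (n - 1). down_step \<mu> \<nu> * g \<nu>)
    = (\<Sum>j\<in>#\<mu>. real j * g (remove_box j \<mu>)) / real n"
proof -
  have "(\<Sum>\<nu>\<in>partitions (n - 1). down_step \<mu> \<nu> * g \<nu>)
      = (\<Sum>\<nu>\<in>partitions (n - 1). \<Sum>j\<in>set_mset \<mu>.
          if \<nu> = remove_box j \<mu> then real j * real (count \<mu> j) / real n * g \<nu> else 0)"
    using assms unfolding down_step_def sum_distrib_right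
    by (intro sum.cong refl) (auto simp: partitions_def)
  also have "\<dots> = (\<Sum>j\<in>set_mset \<mu>. real j * real (count \<mu> j) / real n * g (remove_box j \<mu>))"
    using remove_box_in_partitions[OF assms]
    by (subst sum.swap) (auto simp: finite_partitions intro!: sum.cong)
  also have "\<dots> = (\<Sum>j\<in>#\<mu>. real j * g (remove_box j \<mu>)) / real n"
    unfolding sum_count_eq_sum_mset[symmetric] sum_divide_distrib
    by (intro sum.cong) (auto simp: algebra_simps)
  finally show ?thesis .
qed

lemma up_step_expectation:
  assumes "\<mu> \<in> partitions n"
  shows "(\<Sum>\<nu>\<in>partitions (n + 1). up_step \<theta> \<alpha> \<mu> \<nu> * g \<nu>)
    = ((\<Sum>k\<in>#\<mu>. (real k - \<alpha>) * g (add_box k \<mu>))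
       + (\<theta> + \<alpha> * real (size \<mu>)) * g (add_mset 1 \<mu>)) / (\<theta> + real n)"
proof -
  let ?d = "\<theta> + real n" and ?c = "\<theta> + \<alpha> * real (size \<mu>)"
  let ?w = "\<lambda>k. (real k - \<alpha>) * real (count \<mu> k)"
  have new: "add_mset 1 \<mu> \<in> partitions (n + 1)" using assms by (auto simp: partitions_def)
  have "(\<Sum>\<nu>\<in>partitions (n + 1). up_step \<theta> \<alpha> \<mu> \<nu> * g \<nu>)
      = (\<Sum>\<nu>\<in>partitions (n + 1).
          (\<Sum>k\<in>set_mset \<mu>. if \<nu> = add_box k \<mu> then ?w k / ?d * g \<nu> else 0)
          + (if \<nu> = add_mset 1 \<mu> then ?c / ?d * g \<nu> else 0))"
    using assms unfolding up_step_def distrib_right sum_distrib_right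
    by (intro sum.cong arg_cong2[where f = "(+)"] refl) (auto simp: partitions_def)
  also have "\<dots> = (\<Sum>\<nu>\<in>partitions (n + 1).
          \<Sum>k\<in>set_mset \<mu>. if \<nu> = add_box k \<mu> then ?w k / ?d * g \<nu> else 0)
        + ?c / ?d * g (add_mset 1 \<mu>)"
    using new by (simp add: sum.distrib finite_partitions)
  also have "(\<Sum>\<nu>\<in>partitions (n + 1).
          \<Sum>k\<in>set_mset \<mu>. if \<nu> = add_box k \<mu> then ?w k / ?d * g \<nu> else 0)
      = (\<Sum>k\<in>set_mset \<mu>. ?w k / ?d * g (add_box k \<mu>))"
    using add_box_in_partitions[OF assms]
    by (subst sum.swap) (auto simp: finite_partitions intro!: sum.cong)
  also have "\<dots> = (\<Sum>k\<in>#\<mu>. (real k - \<alpha>) * g (add_box k \<mu>)) / ?d"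
    unfolding sum_count_eq_sum_mset[symmetric] sum_divide_distrib
    by (intro sum.cong) (auto simp: algebra_simps)
  finally show ?thesis by (simp only: add_divide_distrib times_divide_eq_left distrib_right)
qed

lemma down_step_nonneg: "down_step \<mu> \<nu> \<ge> 0"
  unfolding down_step_def by (intro sum_nonneg) (auto simp del: of_nat_sum_mset)

section \<open>The commutation relation\<close>

text \<open>Either the enlarged row shrinks again, restoring \<open>\<mu>\<close>, or another row
  shrinks and the enlarged one survives. As \<open>k \<noteq> 0\<close>, the size
  \<open>k + 1\<close> avoids the branch of \<open>remove_box\<close> that deletes a row.\<close>

lemma sum_remove_box_add_box:
  assumes "k \<in># \<mu>" "k \<noteq> 0"
  shows "(\<Sum>j\<in>#add_box k \<mu>. real j * f (remove_box j (add_box k \<mu>)))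
    = real (k + 1) * f \<mu>
      + (\<Sum>j\<in>#\<mu> - {#k#}. real j * f (add_mset (k + 1) (remove_box j (\<mu> - {#k#}))))"
proof -
  obtain \<kappa> where \<kappa>: "\<mu> = add_mset k \<kappa>" using assms(1) by (metis mset_add)
  have "(\<Sum>j\<in>#\<kappa>. real j * f (remove_box j (add_mset (Suc k) \<kappa>)))
      = (\<Sum>j\<in>#\<kappa>. real j * f (add_mset (Suc k) (remove_box j \<kappa>)))"
    by (intro arg_cong[where f = sum_mset] image_mset_cong)
       (auto simp: remove_box_def add_mset_commute)
  then show ?thesis
    using assms(2) by (simp add: \<kappa> add_box_def remove_box_def[of "Suc k"])
qed

text \<open>Removing the last box of a row of size 1 destroys the row: the identity move then comes
  from the creation of a new row, with one row less in its weight. This loss \<open>-\<alpha>\<close> is the value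
  of \<open>j - 1 - \<alpha>\<close> at \<open>j = 1\<close>, so that no case distinction is visible on the right-hand side.\<close>

lemma sum_add_box_remove_box:
  assumes "j \<in># \<mu>" "j \<noteq> 0"
  shows "(\<Sum>k\<in>#remove_box j \<mu>. (real k - \<alpha>) * f (add_box k (remove_box j \<mu>)))
      + (\<theta> + \<alpha> * real (size (remove_box j \<mu>))) * f (add_mset 1 (remove_box j \<mu>))
    = (real j - 1 - \<alpha>) * f \<mu> + (\<theta> + \<alpha> * real (size \<mu>)) * f (add_mset 1 (remove_box j \<mu>))
      + (\<Sum>k\<in>#\<mu> - {#j#}. (real k - \<alpha>) * f (add_mset (k + 1) (remove_box j (\<mu> - {#k#}))))"
proof -
  obtain \<kappa> where \<kappa>: "\<mu> = add_mset j \<kappa>" using assms by (metis mset_add)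
  \<comment> \<open>Growing row \<open>k\<close> and shrinking row \<open>j\<close> act on different
    rows and commute; for \<open>j = 1\<close> nothing remains of row \<open>j\<close>.\<close>
  have *: "(\<Sum>k\<in>#\<kappa>. (real k - \<alpha>) * f (add_mset (k + 1) (remove_box j (add_mset j \<kappa> - {#k#}))))
    = (\<Sum>k\<in>#\<kappa>. (real k - \<alpha>) * f (if j = 1 then add_box k \<kappa> else add_box k (add_mset (j - 1) \<kappa>)))"
    by (intro arg_cong[where f = sum_mset] image_mset_cong)
       (auto simp: remove_box_def add_box_def dest!: multi_member_split)
  show ?thesis
  proof (cases "j = 1")
    case True
    then show ?thesis using * by (simp add: \<kappa> remove_box_def algebra_simps)
  next
    case False
    then have "add_box (j - 1) (add_mset (j - 1) \<kappa>) = \<mu>"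
      using assms(2) by (simp add: \<kappa> add_box_def)
    then show ?thesis using * False assms(2) by (simp add: \<kappa> remove_box_def of_nat_diff)
  qed
qed

text \<open>The commutation relation without denominators, tested on a function \<open>f\<close>.
  Moves on two different rows, and moves that create a row and shrink an old one, agree in both
  orders; only the returns to \<open>\<mu>\<close> have different weights.\<close>

lemma up_down_commutation:
  fixes f :: "nat multiset \<Rightarrow> real"
  assumes "\<mu> \<in> partitions n"
  shows "(\<Sum>k\<in>#\<mu>. (real k - \<alpha>) * (\<Sum>j\<in>#add_box k \<mu>. real j * f (remove_box j (add_box k \<mu>))))
      + (\<theta> + \<alpha> * real (size \<mu>))
        * (\<Sum>j\<in>#add_mset 1 \<mu>. real j * f (remove_box j (add_mset 1 \<mu>)))
    = (\<Sum>j\<in>#\<mu>. real j * ((\<Sum>k\<in>#remove_box j \<mu>. (real k - \<alpha>) * f (add_box k (remove_box j \<mu>)))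
        + (\<theta> + \<alpha> * real (size (remove_box j \<mu>))) * f (add_mset 1 (remove_box j \<mu>))))
      + (\<theta> + 2 * real n) * f \<mu>" (is "?UD = ?DU + _")
proof -
  let ?c = "\<theta> + \<alpha> * real (size \<mu>)"
  let ?F = "\<lambda>k j. (real k - \<alpha>) * real j * f (add_mset (k + 1) (remove_box j (\<mu> - {#k#})))"
  let ?G = "\<Sum>j\<in>#\<mu>. real j * f (add_mset 1 (remove_box j \<mu>))"
  have pos: "k \<noteq> 0" if "k \<in># \<mu>" for k using assms that by (auto simp: partitions_def intro: gr0I)
  have new: "(\<Sum>j\<in>#add_mset 1 \<mu>. real j * f (remove_box j (add_mset 1 \<mu>))) = f \<mu> + ?G"
  proof -
    have "(\<Sum>j\<in>#\<mu>. real j * f (remove_box j (add_mset 1 \<mu>))) = ?G"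
      by (intro arg_cong[where f = sum_mset] image_mset_cong)
         (auto simp: remove_box_def add_mset_commute)
    then show ?thesis by (simp add: remove_box_def[of "Suc 0"])
  qed
  have "(\<Sum>k\<in>#\<mu>. (real k - \<alpha>) * (\<Sum>j\<in>#add_box k \<mu>. real j * f (remove_box j (add_box k \<mu>))))
      = (\<Sum>k\<in>#\<mu>. (real k - \<alpha>) * real (k + 1) * f \<mu> + (\<Sum>j\<in>#\<mu> - {#k#}. ?F k j))"
    by (intro arg_cong[where f = sum_mset] image_mset_cong)
       (simp add: sum_remove_box_add_box pos sum_mset_distrib_left distrib_left mult.assoc)
  then have UD: "?UD = (\<Sum>k\<in>#\<mu>. (real k - \<alpha>) * real (k + 1)) * f \<mu>
      + (\<Sum>k\<in>#\<mu>. \<Sum>j\<in>#\<mu> - {#k#}. ?F k j) + ?c * (f \<mu> + ?G)"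
    unfolding new by (simp add: sum_mset.distrib sum_mset_distrib_right)
  have "?DU = (\<Sum>j\<in>#\<mu>. real j * (real j - 1 - \<alpha>) * f \<mu>
      + ?c * (real j * f (add_mset 1 (remove_box j \<mu>))) + (\<Sum>k\<in>#\<mu> - {#j#}. ?F k j))"
  proof (intro arg_cong[where f = sum_mset] image_mset_cong, goal_cases)
    case (1 j)
    show ?case
      unfolding sum_add_box_remove_box[OF 1 pos[OF 1]] distrib_left sum_mset_distrib_left
      by (simp add: mult_ac)
  qed
  then have DU: "?DU = (\<Sum>j\<in>#\<mu>. real j * (real j - 1 - \<alpha>)) * f \<mu> + ?c * ?G
      + (\<Sum>j\<in>#\<mu>. \<Sum>k\<in>#\<mu> - {#j#}. ?F k j)"
    by (simp add: sum_mset.distrib sum_mset_distrib_right sum_mset_distrib_left)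
  \<comment> \<open>Row by row this is \<open>(k - \<alpha>) * (k + 1) + \<alpha> = k * (k - 1 -
    \<alpha>) + 2 * k\<close>, with the extra \<open>\<alpha>\<close> coming from the returns
    through a new row. The terms \<open>2 * k\<close> add up to \<open>2 * n\<close>.\<close>
  have "(\<Sum>k\<in>#M. (real k - \<alpha>) * real (k + 1)) + \<alpha> * real (size M)
      = (\<Sum>k\<in>#M. real k * (real k - 1 - \<alpha>)) + 2 * real (sum_mset M)" for M
    by (induction M) (simp_all add: algebra_simps)
  from this[of \<mu>] have coeff: "(\<Sum>k\<in>#\<mu>. (real k - \<alpha>) * real (k + 1)) + \<alpha> * real (size \<mu>)
      = (\<Sum>k\<in>#\<mu>. real k * (real k - 1 - \<alpha>)) + 2 * real n"
    using assms by (simp add: partitions_def del: of_nat_sum_mset)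
  have "?UD = ((\<Sum>k\<in>#\<mu>. (real k - \<alpha>) * real (k + 1)) + \<alpha> * real (size \<mu>)) * f \<mu> + \<theta> * f \<mu>
      + ?c * ?G + (\<Sum>k\<in>#\<mu>. \<Sum>j\<in>#\<mu> - {#k#}. ?F k j)"
    unfolding UD by (simp only: algebra_simps)
  then show ?thesis
    unfolding coeff DU sum_mset_pairs_swap[of ?F] by (simp only: algebra_simps)
qed

text \<open>The commutation relation with its denominators restored:
  \<open>(n + 1) * (\<theta> + n)\<close> for the up-down chain and
  \<open>n * (\<theta> + n - 1)\<close> for the down-up chain.\<close>

lemma up_down_chain_eq:
  assumes "\<theta> > 0" "n \<ge> 1" "\<mu> \<in> partitions n"
  shows "up_down_chain \<theta> \<alpha> n \<mu> \<rho>
    = real n * (\<theta> + real n - 1) / ((real n + 1) * (\<theta> + real n)) * down_up_chain \<theta> \<alpha> n \<mu> \<rho>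
      + (\<theta> + 2 * real n) / ((real n + 1) * (\<theta> + real n)) * of_bool (\<mu> = \<rho>)"
proof -
  \<comment> \<open>The indicator of \<open>\<rho>\<close> turns one-step expectations into
    transition probabilities to \<open>\<rho>\<close>.\<close>
  let ?f = "\<lambda>\<nu>. of_bool (\<rho> = \<nu>) :: real"
  let ?D = "\<lambda>\<nu>. \<Sum>j\<in>#\<nu>. real j * ?f (remove_box j \<nu>)"
  let ?U = "\<lambda>\<nu>. (\<Sum>k\<in>#\<nu>. (real k - \<alpha>) * ?f (add_box k \<nu>))
    + (\<theta> + \<alpha> * real (size \<nu>)) * ?f (add_mset 1 \<nu>)"
  have "up_down_chain \<theta> \<alpha> n \<mu> \<rho>
      = (\<Sum>\<nu>\<in>partitions (n + 1). up_step \<theta> \<alpha> \<mu> \<nu> * ?D \<nu>) / (real n + 1)"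
    unfolding up_down_chain_def sum_divide_distrib
    by (intro sum.cong refl) (auto simp: down_step_eq partitions_def)
  also have "(\<Sum>\<nu>\<in>partitions (n + 1). up_step \<theta> \<alpha> \<mu> \<nu> * ?D \<nu>)
      = ((\<Sum>j\<in>#\<mu>. real j * ?U (remove_box j \<mu>)) + (\<theta> + 2 * real n) * ?f \<mu>) / (\<theta> + real n)"
    unfolding up_step_expectation[OF assms(3)]
    using up_down_commutation[OF assms(3), of \<alpha> ?f \<theta>] by (simp only:)
  finally have UD: "up_down_chain \<theta> \<alpha> n \<mu> \<rho>
      = ((\<Sum>j\<in>#\<mu>. real j * ?U (remove_box j \<mu>)) + (\<theta> + 2 * real n) * ?f \<mu>)
        / (\<theta> + real n) / (real n + 1)" .
  have "down_up_chain \<theta> \<alpha> n \<mu> \<rho>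
      = (\<Sum>\<nu>\<in>partitions (n - 1). down_step \<mu> \<nu> * ?U \<nu>) / (\<theta> + real n - 1)"
    unfolding down_up_chain_def sum_divide_distrib
    using assms(2)
    by (intro sum.cong refl) (auto simp: up_step_eq partitions_def of_nat_diff add_diff_eq
        simp del: of_nat_sum_mset)
  also have "\<dots> = (\<Sum>j\<in>#\<mu>. real j * ?U (remove_box j \<mu>)) / real n / (\<theta> + real n - 1)"
    unfolding down_step_expectation[OF assms(3)] ..
  finally have DU: "(\<Sum>j\<in>#\<mu>. real j * ?U (remove_box j \<mu>))
      = real n * (\<theta> + real n - 1) * down_up_chain \<theta> \<alpha> n \<mu> \<rho>"
    using assms(1,2) by simp
  show ?thesis unfolding UD DU
    by (simp add: add_divide_distrib mult_ac eq_commute[of \<rho> \<mu>])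
qed

section \<open>Reversibility\<close>

lemma pitman_pos:
  assumes "\<theta> > 0" "0 \<le> \<alpha>" "\<alpha> < 1"
  shows "pitman \<theta> \<alpha> \<mu> > 0"
proof -
  have "(\<Prod>p\<in>#\<mu>. fact p :: real) > 0" by (induction \<mu>) auto
  moreover have "(\<Prod>p\<in>#\<mu>. \<Prod>j=2..p. real j - 1 - \<alpha>) > 0"
    using assms by (induction \<mu>) (auto intro!: mult_pos_pos prod_pos)
  ultimately show ?thesis
    using assms unfolding pitman_def
    by (intro mult_pos_pos divide_pos_pos prod_pos pochhammer_pos) (auto intro: add_pos_nonneg)
qed

lemma pitman_add_mset:
  "pitman \<theta> \<alpha> (add_mset k \<kappa>)
    = (\<Prod>i<Suc (size \<kappa>). \<theta> + real i * \<alpha>) / pochhammer \<theta> (k + sum_mset \<kappa>)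
      * (fact (k + sum_mset \<kappa>) / (real (count \<kappa> k + 1)
          * (\<Prod>k\<in>set_mset \<kappa>. fact (count \<kappa> k)) * (fact k * (\<Prod>p\<in>#\<kappa>. fact p))))
      * ((\<Prod>j=2..k. real j - 1 - \<alpha>) * (\<Prod>p\<in>#\<kappa>. \<Prod>j=2..p. real j - 1 - \<alpha>))"
  by (simp only: pitman_def prod_fact_count_add_mset size_add_mset sum_mset.add_mset
      image_mset_add_mset prod_mset.add_mset mult.assoc)

text \<open>Detailed balance for the move between sizes \<open>k\<close> and \<open>k + 1\<close>.
  Both partitions are a common rest \<open>\<kappa>\<close> plus one row, so most factors of the two
  weights coincide.\<close>

lemma pitman_add_box:
  assumes "\<theta> > 0" "k \<in># \<mu>" "k \<noteq> 0"
  shows "pitman \<theta> \<alpha> \<mu> * ((real k - \<alpha>) * real (count \<mu> k) / (\<theta> + real (sum_mset \<mu>)))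
    = pitman \<theta> \<alpha> (add_box k \<mu>)
      * (real (k + 1) * real (count (add_box k \<mu>) (k + 1)) / real (sum_mset \<mu> + 1))"
proof -
  obtain \<kappa> where \<kappa>: "\<mu> = add_mset k \<kappa>" using assms by (metis mset_add)
  \<comment> \<open>Here \<open>c\<close> and \<open>d\<close> are the multiplicities of
    \<open>k\<close> and \<open>k + 1\<close> in the two partitions, \<open>q\<close> is
    \<open>k + 1\<close>, \<open>u\<close> the upper level, \<open>a\<close> is
    \<open>k - \<alpha>\<close>, and \<open>p\<close>, \<open>t\<close> are the Pochhammer symbol
    and its next factor.\<close>
  have cancel: "T / p * (F / (c * P * (f * G))) * (W * V) * (a * c / t)
      = T / (p * t) * (u * F / (d * P * (q * f * G))) * (W * a * V) * (q * d / u)"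
    if "c > 0" "d > 0" "q > 0" "u > 0" for T p F c P f G W V a t u d q :: real
    using that by (simp add: divide_simps)
  \<comment> \<open>The new box in column \<open>k + 1\<close> contributes
    \<open>(k + 1) - 1 - \<alpha>\<close>. This needs \<open>k \<ge> 1\<close>, as the product omits
    column 1.\<close>
  have "(\<Prod>j=2..k + 1. real j - 1 - \<alpha>) = (\<Prod>j=2..k. real j - 1 - \<alpha>) * (real k - \<alpha>)"
    using assms(3) by (simp add: prod.cl_ivl_Suc)
  then have "pitman \<theta> \<alpha> (add_mset (k + 1) \<kappa>)
      = (\<Prod>i<Suc (size \<kappa>). \<theta> + real i * \<alpha>)
          / (pochhammer \<theta> (k + sum_mset \<kappa>) * (\<theta> + real (k + sum_mset \<kappa>)))
        * (real (k + sum_mset \<kappa> + 1) * fact (k + sum_mset \<kappa>) / (real (count \<kappa> (k + 1) + 1)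
          * (\<Prod>k\<in>set_mset \<kappa>. fact (count \<kappa> k)) * (real (k + 1) * fact k * (\<Prod>p\<in>#\<kappa>. fact p))))
        * ((\<Prod>j=2..k. real j - 1 - \<alpha>) * (real k - \<alpha>)
          * (\<Prod>p\<in>#\<kappa>. \<Prod>j=2..p. real j - 1 - \<alpha>))"
    unfolding pitman_add_mset by (simp add: pochhammer_Suc del: of_nat_sum_mset prod.lessThan_Suc)
  moreover have "count \<mu> k = count \<kappa> k + 1" "count (add_box k \<mu>) (k + 1) = count \<kappa> (k + 1) + 1"
    "sum_mset \<mu> = k + sum_mset \<kappa>" "add_box k \<mu> = add_mset (k + 1) \<kappa>"
    by (simp_all add: \<kappa> add_box_def)
  ultimately show ?thesis
    unfolding \<kappa> pitman_add_mset[of \<theta> \<alpha> k] by (simp only:) (rule cancel; simp add: add_pos_nonneg del: of_nat_sum_mset)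
qed

text \<open>Detailed balance for the creation of a row: the new factor of the product over rows is
  the numerator of the up probability, and a row of size 1 has no box outside the first
  column.\<close>

lemma pitman_add_row:
  assumes "\<theta> > 0"
  shows "pitman \<theta> \<alpha> \<mu> * ((\<theta> + \<alpha> * real (size \<mu>)) / (\<theta> + real (sum_mset \<mu>)))
    = pitman \<theta> \<alpha> (add_mset 1 \<mu>) * (real (count (add_mset 1 \<mu>) 1) / real (sum_mset \<mu> + 1))"
proof -
  have cancel: "T / p * (F / (P * G)) * V * (a / t)
      = T * a / (p * t) * (u * F / (d * P * G)) * V * (d / u)"
    if "d > 0" "u > 0" for T p F P G V a t u d :: real
    using that by (simp add: divide_simps)
  have "pitman \<theta> \<alpha> (add_mset 1 \<mu>)
      = (\<Prod>i<size \<mu>. \<theta> + real i * \<alpha>) * (\<theta> + \<alpha> * real (size \<mu>))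
          / (pochhammer \<theta> (sum_mset \<mu>) * (\<theta> + real (sum_mset \<mu>)))
        * (real (sum_mset \<mu> + 1) * fact (sum_mset \<mu>) / (real (count \<mu> 1 + 1)
          * (\<Prod>k\<in>set_mset \<mu>. fact (count \<mu> k)) * (\<Prod>p\<in>#\<mu>. fact p)))
        * (\<Prod>p\<in>#\<mu>. \<Prod>j=2..p. real j - 1 - \<alpha>)"
    unfolding pitman_add_mset by (simp add: pochhammer_Suc mult.commute[of \<alpha>] del: of_nat_sum_mset)
  moreover have "count (add_mset 1 \<mu>) 1 = count \<mu> 1 + 1" by simp
  ultimately show ?thesis
    unfolding pitman_def[of \<theta> \<alpha> \<mu>] by (simp only:) (rule cancel; simp add: add_pos_nonneg del: of_nat_sum_mset)
qed

text \<open>Every up move from \<open>\<mu>\<close> to \<open>\<nu>\<close> is undone by exactly one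
  size of down move: growing a row of size \<open>k\<close> by removal at size \<open>k + 1\<close>,
  creating a row by removal at size 1. Detailed balance is then summed over these pairs.\<close>

lemma reversibility:
  assumes "\<theta> > 0" "\<mu> \<in> partitions n" "\<nu> \<in> partitions (n + 1)"
  shows "pitman \<theta> \<alpha> \<mu> * up_step \<theta> \<alpha> \<mu> \<nu> = pitman \<theta> \<alpha> \<nu> * down_step \<nu> \<mu>"
proof -
  let ?u = "\<lambda>k. pitman \<theta> \<alpha> \<mu> * ((real k - \<alpha>) * real (count \<mu> k) / (\<theta> + real (sum_mset \<mu>)))"
  let ?v = "\<lambda>j. pitman \<theta> \<alpha> \<nu> * (real j * real (count \<nu> j) / real (sum_mset \<nu>))"
  let ?A = "{k \<in> set_mset \<mu>. \<nu> = add_box k \<mu>}"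
  let ?B = "{j \<in> set_mset \<nu>. \<mu> = remove_box j \<nu>}"
  have \<mu>: "0 \<notin># \<mu>" "sum_mset \<mu> = n" and \<nu>: "0 \<notin># \<nu>" "sum_mset \<nu> = n + 1"
    using assms by (auto simp: partitions_def)
  have up: "pitman \<theta> \<alpha> \<mu> * up_step \<theta> \<alpha> \<mu> \<nu> = sum ?u ?A + (if \<nu> = add_mset 1 \<mu>
      then pitman \<theta> \<alpha> \<mu> * ((\<theta> + \<alpha> * real (size \<mu>)) / (\<theta> + real (sum_mset \<mu>))) else 0)"
    unfolding up_step_def distrib_left sum_distrib_left
    by (simp add: sum.inter_filter if_distrib[of "(*) _"] cong: if_cong)
  have down: "pitman \<theta> \<alpha> \<nu> * down_step \<nu> \<mu> = sum ?v ?B"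
    unfolding down_step_def sum_distrib_left
    by (simp add: sum.inter_filter if_distrib[of "(*) _"] cong: if_cong)
  have "?B = Suc ` ?A \<union> (if \<nu> = add_mset 1 \<mu> then {1} else {})"
  proof (intro set_eqI iffI)
    fix j assume "j \<in> ?B"
    then have j: "j \<in># \<nu>" "\<mu> = remove_box j \<nu>" by auto
    then obtain \<kappa> where \<kappa>: "\<nu> = add_mset j \<kappa>" by (metis mset_add)
    show "j \<in> Suc ` ?A \<union> (if \<nu> = add_mset 1 \<mu> then {1} else {})"
    proof (cases "j = 1")
      case True
      then show ?thesis using j \<kappa> by (simp add: remove_box_def)
    next
      case False
      then obtain i where "j = Suc i" using j \<nu> by (cases j) auto
      then show ?thesis using j \<kappa> False by (auto simp: remove_box_def add_box_def)
    qed
  next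
    fix j assume "j \<in> Suc ` ?A \<union> (if \<nu> = add_mset 1 \<mu> then {1} else {})"
    then consider k where "j = Suc k" "k \<in># \<mu>" "\<nu> = add_box k \<mu>" | "j = 1" "\<nu> = add_mset 1 \<mu>"
      by (auto split: if_splits)
    then show "j \<in> ?B"
    proof cases
      case 1
      then have "k \<noteq> 0" using \<mu> by metis
      with 1 show ?thesis by (auto simp: remove_box_def add_box_def)
    qed (simp add: remove_box_def)
  qed
  \<comment> \<open>Size 1 would lie in the image only through a row of size 0, which a partition
    does not have.\<close>
  moreover have "Suc ` ?A \<inter> (if \<nu> = add_mset 1 \<mu> then {1} else {}) = {}"
    using \<mu> by auto
  ultimately have "sum ?v ?B = sum ?v (Suc ` ?A) + sum ?v (if \<nu> = add_mset 1 \<mu> then {1} else {})"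
    by (simp add: sum.union_disjoint)
  also have "sum ?v (Suc ` ?A) = sum ?u ?A"
  proof (subst sum.reindex, simp, intro sum.cong refl)
    fix k assume "k \<in> ?A"
    then have "k \<in># \<mu>" "k \<noteq> 0" "\<nu> = add_box k \<mu>" using \<mu> by (auto intro: gr0I)
    then show "(?v \<circ> Suc) k = ?u k"
      using pitman_add_box[OF assms(1), of k \<mu> \<alpha>] \<mu> \<nu> by (simp del: of_nat_sum_mset)
  qed
  also have "sum ?v (if \<nu> = add_mset 1 \<mu> then {1} else {}) = (if \<nu> = add_mset 1 \<mu>
      then pitman \<theta> \<alpha> \<mu> * ((\<theta> + \<alpha> * real (size \<mu>)) / (\<theta> + real (sum_mset \<mu>))) else 0)"
    using pitman_add_row[OF assms(1), of \<alpha> \<mu>] by (simp del: of_nat_sum_mset)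
  finally show ?thesis unfolding up down by simp
qed

section \<open>The extremal pair\<close>

lemma iterate_down_up_chain:
  assumes "x \<in> partitions (n + 1)"
  shows "iterate_kernel (partitions (n + 1)) (down_up_chain \<theta> \<alpha> (n + 1)) (Suc r) x y
    = (\<Sum>b\<in>partitions n. (\<Sum>a\<in>partitions n. down_step x a
        * iterate_kernel (partitions n) (up_down_chain \<theta> \<alpha> n) r a b) * up_step \<theta> \<alpha> b y)"
proof (induction r arbitrary: y)
  case 0
  show ?case using assms
    by (simp add: finite_partitions down_up_chain_def if_distrib[of "\<lambda>t. t * _"]
        if_distrib[of "(*) _"] cong: if_cong)
next
  case (Suc r)
  let ?I = "\<lambda>b. \<Sum>a\<in>partitions n. down_step x a
        * iterate_kernel (partitions n) (up_down_chain \<theta> \<alpha> n) r a b"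
  have "iterate_kernel (partitions (n + 1)) (down_up_chain \<theta> \<alpha> (n + 1)) (Suc (Suc r)) x y
      = (\<Sum>z\<in>partitions (n + 1). (\<Sum>b\<in>partitions n. ?I b * up_step \<theta> \<alpha> b z)
          * (\<Sum>c\<in>partitions n. down_step z c * up_step \<theta> \<alpha> c y))"
    unfolding iterate_kernel.simps(2)[of _ _ "Suc r"] Suc.IH by (simp add: down_up_chain_def)
  also have "\<dots> = (\<Sum>z\<in>partitions (n + 1). \<Sum>b\<in>partitions n. \<Sum>c\<in>partitions n.
      ?I b * (up_step \<theta> \<alpha> b z * down_step z c) * up_step \<theta> \<alpha> c y)"
    by (simp only: sum_product mult.assoc)
  \<comment> \<open>The sum over \<open>z\<close> goes innermost, where the trailing up step and the
    next down step merge into one more step of the up-down chain.\<close>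
  also have "\<dots> = (\<Sum>c\<in>partitions n. \<Sum>b\<in>partitions n. \<Sum>z\<in>partitions (n + 1).
      ?I b * (up_step \<theta> \<alpha> b z * down_step z c) * up_step \<theta> \<alpha> c y)"
    by (subst sum.swap, subst (2) sum.swap, subst sum.swap) (rule refl)
  also have "\<dots> = (\<Sum>c\<in>partitions n. (\<Sum>b\<in>partitions n. ?I b * up_down_chain \<theta> \<alpha> n b c)
      * up_step \<theta> \<alpha> c y)"
    by (simp only: up_down_chain_def sum_distrib_left sum_distrib_right)
  also have "\<dots> = (\<Sum>c\<in>partitions n. (\<Sum>a\<in>partitions n. down_step x a
      * iterate_kernel (partitions n) (up_down_chain \<theta> \<alpha> n) (Suc r) a c) * up_step \<theta> \<alpha> c y)"
  proof (rule sum.cong[OF refl], rule arg_cong2[where f = "(*)", OF _ refl])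
    fix c
    show "(\<Sum>b\<in>partitions n. ?I b * up_down_chain \<theta> \<alpha> n b c) = (\<Sum>a\<in>partitions n. down_step x a
      * iterate_kernel (partitions n) (up_down_chain \<theta> \<alpha> n) (Suc r) a c)"
      unfolding iterate_kernel.simps(2) sum_distrib_left sum_distrib_right mult.assoc
      by (rule sum.swap)
  qed
  finally show ?case .
qed

text \<open>Reversibility trades the final up step into \<open>y\<close>, relative to the weight of
  \<open>y\<close>, for a down step out of \<open>y\<close>. The formula becomes an average over two
  independent down steps.\<close>

lemma iterate_down_up_density:
  assumes "\<theta> > 0" "0 \<le> \<alpha>" "\<alpha> < 1" "x \<in> partitions (n + 1)" "y \<in> partitions (n + 1)"
  shows "iterate_kernel (partitions (n + 1)) (down_up_chain \<theta> \<alpha> (n + 1)) (Suc r) x y / pitman \<theta> \<alpha> y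
    = (\<Sum>a\<in>partitions n. \<Sum>b\<in>partitions n. down_step x a * down_step y b
        * (iterate_kernel (partitions n) (up_down_chain \<theta> \<alpha> n) r a b / pitman \<theta> \<alpha> b))"
proof -
  have pos: "pitman \<theta> \<alpha> \<mu> \<noteq> 0" for \<mu> using pitman_pos[OF assms(1-3), of \<mu>] by simp
  have "up_step \<theta> \<alpha> b y / pitman \<theta> \<alpha> y = down_step y b / pitman \<theta> \<alpha> b"
    if "b \<in> partitions n" for b
    using reversibility[OF assms(1) that assms(5)] pos by (simp add: field_simps)
  then have "iterate_kernel (partitions (n + 1)) (down_up_chain \<theta> \<alpha> (n + 1)) (Suc r) x y / pitman \<theta> \<alpha> y
    = (\<Sum>b\<in>partitions n. (\<Sum>a\<in>partitions n. down_step x a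
        * iterate_kernel (partitions n) (up_down_chain \<theta> \<alpha> n) r a b)
        * (down_step y b / pitman \<theta> \<alpha> b))"
    unfolding iterate_down_up_chain[OF assms(4)] sum_divide_distrib
    by (intro sum.cong refl) (simp only: times_divide_eq_right[symmetric])
  also have "\<dots> = (\<Sum>b\<in>partitions n. \<Sum>a\<in>partitions n. down_step x a * down_step y b
        * (iterate_kernel (partitions n) (up_down_chain \<theta> \<alpha> n) r a b / pitman \<theta> \<alpha> b))"
    unfolding sum_distrib_right by (intro sum.cong refl) simp
  finally show ?thesis by (subst sum.swap)
qed

text \<open>The up-down chain is \<open>a * Q + c\<close> times the identity with
  \<open>a, c \<ge> 0\<close>, so its powers expand as polynomials in \<open>Q\<close>. Only the
  signs of the coefficients matter later.\<close>

lemma iterate_up_down_combination: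
  assumes "\<theta> > 0" "n \<ge> 1"
  shows "\<exists>w :: nat \<Rightarrow> real. (\<forall>i. w i \<ge> 0) \<and> (\<forall>x\<in>partitions n. \<forall>y\<in>partitions n.
    iterate_kernel (partitions n) (up_down_chain \<theta> \<alpha> n) r x y
      = (\<Sum>i\<le>r. w i * iterate_kernel (partitions n) (down_up_chain \<theta> \<alpha> n) i x y))"
proof (induction r)
  case 0
  show ?case by (intro exI[of _ "\<lambda>_. 1"]) simp
next
  case (Suc r)
  let ?S = "partitions n"
  let ?Q = "iterate_kernel ?S (down_up_chain \<theta> \<alpha> n)"
  define a where "a = real n * (\<theta> + real n - 1) / ((real n + 1) * (\<theta> + real n))"
  define c where "c = (\<theta> + 2 * real n) / ((real n + 1) * (\<theta> + real n))"
  have ac: "a \<ge> 0" "c \<ge> 0" using assms by (simp_all add: a_def c_def)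
  obtain w :: "nat \<Rightarrow> real" where w: "\<And>i. w i \<ge> 0"
    and IH: "\<And>x y. x \<in> ?S \<Longrightarrow> y \<in> ?S \<Longrightarrow>
      iterate_kernel ?S (up_down_chain \<theta> \<alpha> n) r x y = (\<Sum>i\<le>r. w i * ?Q i x y)"
    using Suc.IH by blast
  \<comment> \<open>The coefficients of the old polynomial times \<open>a * Q + c\<close>: one copy
    shifted by one degree, one in place. The cutoff at \<open>r\<close> discards values of
    \<open>w\<close> beyond the old degree.\<close>
  define v where
    "v i = (if i = 0 then 0 else a * w (i - 1)) + (if i \<le> r then c * w i else 0)" for i
  have "iterate_kernel ?S (up_down_chain \<theta> \<alpha> n) (Suc r) x y = (\<Sum>i\<le>Suc r. v i * ?Q i x y)"
    if xy: "x \<in> ?S" "y \<in> ?S" for x y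
  proof -
    have "iterate_kernel ?S (up_down_chain \<theta> \<alpha> n) (Suc r) x y
        = (\<Sum>z\<in>?S. \<Sum>i\<le>r. a * w i * (?Q i x z * down_up_chain \<theta> \<alpha> n z y)
            + c * w i * (if z = y then ?Q i x z else 0))"
      unfolding iterate_kernel.simps(2)
    proof (rule sum.cong[OF refl])
      fix z assume z: "z \<in> ?S"
      have "iterate_kernel ?S (up_down_chain \<theta> \<alpha> n) r x z * up_down_chain \<theta> \<alpha> n z y
          = (\<Sum>i\<le>r. w i * ?Q i x z) * (a * down_up_chain \<theta> \<alpha> n z y + c * of_bool (z = y))"
        by (simp only: IH[OF xy(1) z] up_down_chain_eq[OF assms z] a_def c_def)
      also have "\<dots> = (\<Sum>i\<le>r. a * w i * (?Q i x z * down_up_chain \<theta> \<alpha> n z y)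
            + c * w i * (if z = y then ?Q i x z else 0))"
        unfolding sum_distrib_right by (intro sum.cong refl) (simp add: algebra_simps)
      finally show "iterate_kernel ?S (up_down_chain \<theta> \<alpha> n) r x z * up_down_chain \<theta> \<alpha> n z y
          = (\<Sum>i\<le>r. a * w i * (?Q i x z * down_up_chain \<theta> \<alpha> n z y)
            + c * w i * (if z = y then ?Q i x z else 0))" .
    qed
    also have "\<dots> = (\<Sum>i\<le>r. a * w i * ?Q (Suc i) x y + c * w i * ?Q i x y)"
      using xy by (subst sum.swap)
        (simp add: sum.distrib finite_partitions flip: sum_distrib_left)
    also have "\<dots> = (\<Sum>i\<le>r. a * w i * ?Q (Suc i) x y) + (\<Sum>i\<le>r. c * w i * ?Q i x y)"
      by (rule sum.distrib)
    also have "(\<Sum>i\<le>r. a * w i * ?Q (Suc i) x y)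
        = (\<Sum>i\<le>Suc r. (if i = 0 then 0 else a * w (i - 1)) * ?Q i x y)"
      unfolding sum.atMost_Suc_shift by simp
    also have "(\<Sum>i\<le>r. c * w i * ?Q i x y)
        = (\<Sum>i\<le>Suc r. (if i \<le> r then c * w i else 0) * ?Q i x y)"
      by simp
    finally show ?thesis by (simp only: v_def distrib_right sum.distrib)
  qed
  moreover have "v i \<ge> 0" for i using w ac by (simp add: v_def)
  ultimately show ?case by blast
qed

section \<open>The one-row and one-column partitions\<close>

lemma one_row_in_partitions: "n \<ge> 1 \<Longrightarrow> {#n#} \<in> partitions n"
  by (simp add: partitions_def)

lemma one_column_in_partitions: "replicate_mset n 1 \<in> partitions n"
  by (auto simp: partitions_def)

text \<open>The case \<open>n = 0\<close> is excluded since removing the only box leaves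
  \<open>{#}\<close>, not a row of size 0.\<close>

lemma down_step_one_row: "n \<ge> 1 \<Longrightarrow> down_step {#n + 1#} \<nu> = of_bool (\<nu> = {#n#})"
  by (simp add: down_step_def remove_box_def)

lemma down_step_one_column:
  "down_step (replicate_mset (n + 1) 1) \<nu> = of_bool (\<nu> = replicate_mset n 1)"
  by (simp add: down_step_def remove_box_def)

lemma iterate_down_up_density_extremal:
  assumes "\<theta> > 0" "0 \<le> \<alpha>" "\<alpha> < 1" "n \<ge> 1"
  shows "iterate_kernel (partitions (n + 1)) (down_up_chain \<theta> \<alpha> (n + 1)) (Suc r)
        {#n + 1#} (replicate_mset (n + 1) 1) / pitman \<theta> \<alpha> (replicate_mset (n + 1) 1)
    = iterate_kernel (partitions n) (up_down_chain \<theta> \<alpha> n) r {#n#} (replicate_mset n 1)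
      / pitman \<theta> \<alpha> (replicate_mset n 1)"
proof -
  let ?S = "partitions n"
  let ?k = "\<lambda>a b. iterate_kernel ?S (up_down_chain \<theta> \<alpha> n) r a b / pitman \<theta> \<alpha> b"
  have "{#n + 1#} \<in> partitions (n + 1)" by (rule one_row_in_partitions) simp
  note iterate_down_up_density[OF assms(1-3) this one_column_in_partitions]
  also have "(\<Sum>a\<in>?S. \<Sum>b\<in>?S. down_step {#n + 1#} a * down_step (replicate_mset (n + 1) 1) b * ?k a b)
      = (\<Sum>a\<in>?S. \<Sum>b\<in>?S. if b = replicate_mset n 1 then if a = {#n#} then ?k a b else 0 else 0)"
    unfolding down_step_one_row[OF assms(4)] down_step_one_column by (intro sum.cong refl) auto
  also have "\<dots> = ?k {#n#} (replicate_mset n 1)"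
    using one_row_in_partitions[OF assms(4)] one_column_in_partitions[of n]
    by (simp add: finite_partitions)
  finally show ?thesis .
qed

text \<open>An average with probability weights is at least any lower bound \<open>m\<close> of the
  averaged values.\<close>

lemma iterate_down_up_density_ge:
  assumes "\<theta> > 0" "0 \<le> \<alpha>" "\<alpha> < 1" "x \<in> partitions (n + 1)" "y \<in> partitions (n + 1)"
    and m: "\<And>a b. a \<in> partitions n \<Longrightarrow> b \<in> partitions n \<Longrightarrow>
      m \<le> iterate_kernel (partitions n) (up_down_chain \<theta> \<alpha> n) r a b / pitman \<theta> \<alpha> b"
  shows "m \<le> iterate_kernel (partitions (n + 1)) (down_up_chain \<theta> \<alpha> (n + 1)) (Suc r) x y
    / pitman \<theta> \<alpha> y"
proof -
  have one: "(\<Sum>a\<in>partitions n. down_step z a) = 1" if "z \<in> partitions (n + 1)" for z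
    using down_step_sum[OF that] by simp
  have "(\<Sum>a\<in>partitions n. \<Sum>b\<in>partitions n. down_step x a * down_step y b * m)
      = (\<Sum>a\<in>partitions n. down_step x a) * (\<Sum>b\<in>partitions n. down_step y b) * m"
    unfolding sum_product unfolding sum_distrib_right ..
  then have "m = (\<Sum>a\<in>partitions n. \<Sum>b\<in>partitions n. down_step x a * down_step y b * m)"
    using assms(4,5) by (simp add: one)
  also have "\<dots> \<le> (\<Sum>a\<in>partitions n. \<Sum>b\<in>partitions n. down_step x a * down_step y b
        * (iterate_kernel (partitions n) (up_down_chain \<theta> \<alpha> n) r a b / pitman \<theta> \<alpha> b))"
    by (intro sum_mono mult_left_mono m mult_nonneg_nonneg down_step_nonneg)
  finally show ?thesis unfolding iterate_down_up_density[OF assms(1-5)] .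
qed

lemma iterate_up_down_density_ge:
  assumes "\<theta> > 0" "0 \<le> \<alpha>" "\<alpha> < 1" "n \<ge> 1" "x \<in> partitions n" "y \<in> partitions n"
  shows "iterate_kernel (partitions n) (up_down_chain \<theta> \<alpha> n) r {#n#} (replicate_mset n 1)
      / pitman \<theta> \<alpha> (replicate_mset n 1)
    \<le> iterate_kernel (partitions n) (up_down_chain \<theta> \<alpha> n) r x y / pitman \<theta> \<alpha> y"
  using assms(4-6)
\<comment> \<open>The exponent is generalised because each power \<open>j + 1\<close> of the down-up
  chain calls for the hypothesis at power \<open>j\<close> one level below.\<close>
proof (induction n arbitrary: r x y rule: dec_induct)
  case base
  have "partitions 1 = {{#1#}}"
  proof -
    have "\<mu> = {#1#}" if "\<mu> \<in> partitions 1" for \<mu>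
    proof -
      have "\<mu> \<noteq> {#}" using that by (auto simp: partitions_def)
      then obtain k \<kappa> where \<mu>: "\<mu> = add_mset k \<kappa>" by (meson multiset_cases)
      then have "k + sum_mset \<kappa> = 1" "k \<noteq> 0" "0 \<notin># \<kappa>" using that by (auto simp: partitions_def)
      then show ?thesis using \<mu> by (cases \<kappa>) auto
    qed
    then show ?thesis by (auto simp: partitions_def)
  qed
  then show ?case using base by simp
next
  case (step n)
  let ?S = "partitions (Suc n)" and ?row = "{#Suc n#}" and ?col = "replicate_mset (Suc n) (1::nat)"
  let ?Q = "iterate_kernel ?S (down_up_chain \<theta> \<alpha> (Suc n))"
  have rc: "?row \<in> ?S" "?col \<in> ?S"
    using one_row_in_partitions[of "Suc n"] one_column_in_partitions[of "Suc n"] by simp_all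
  have Q: "?Q i ?row ?col / pitman \<theta> \<alpha> ?col \<le> ?Q i x y / pitman \<theta> \<alpha> y" for i
  proof (cases i)
    case 0
    \<comment> \<open>From level 2 on the row and the column differ, so their entry of the identity
      is 0, the least value possible. At level 1 there is only one state.\<close>
    have "?row \<noteq> ?col"
      using step.hyps by (auto dest: arg_cong[where f = size])
    then have "?Q i ?row ?col = 0" using 0 by (simp del: replicate_mset_Suc)
    then show ?thesis
      using 0 less_imp_le[OF pitman_pos[OF assms(1-3)]] by simp
  next
    case (Suc j)
    show ?thesis unfolding Suc
      using iterate_down_up_density_ge[OF assms(1-3), of x n y _ j] step
        iterate_down_up_density_extremal[OF assms(1-3), of n j]
      by (simp del: replicate_mset_Suc iterate_kernel.simps)
  qed
  obtain w :: "nat \<Rightarrow> real" where w: "\<And>i. w i \<ge> 0"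
    and K: "\<And>x y. x \<in> ?S \<Longrightarrow> y \<in> ?S \<Longrightarrow>
      iterate_kernel ?S (up_down_chain \<theta> \<alpha> (Suc n)) r x y = (\<Sum>i\<le>r. w i * ?Q i x y)"
    using iterate_up_down_combination[OF assms(1), of "Suc n" \<alpha> r] by auto
  show ?case
    \<comment> \<open>All powers of the down-up chain have their least density at the same pair,
      hence so does every nonnegative combination.\<close>
    unfolding K[OF rc] K[OF step.prems] sum_divide_distrib times_divide_eq_right[symmetric]
    by (intro sum_mono mult_left_mono Q w)
qed

section \<open>Comparison of the separation distances\<close>

lemma max_separation_eq:
  assumes "finite S" "x\<^sub>0 \<in> S" "y\<^sub>0 \<in> S"
    and "\<And>x y. x \<in> S \<Longrightarrow> y \<in> S \<Longrightarrow>
      iterate_kernel S K r x\<^sub>0 y\<^sub>0 / \<pi> y\<^sub>0 \<le> iterate_kernel S K r x y / \<pi> y"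
  shows "max_separation S K \<pi> r = 1 - iterate_kernel S K r x\<^sub>0 y\<^sub>0 / \<pi> y\<^sub>0"
  unfolding max_separation_def using assms by (intro Max_eqI) auto

theorem proposition7p7:
  fixes \<theta> \<alpha> :: real and n r :: nat
  assumes "\<theta> > 0" and "0 \<le> \<alpha>" and "\<alpha> < 1" and "n \<ge> 1"
  shows "sep_up_down \<theta> \<alpha> n r = sep_down_up \<theta> \<alpha> (n + 1) (r + 1)"
proof -
  note params = assms(1-3)
  note ge = iterate_up_down_density_ge[OF assms]
  note extremal = iterate_down_up_density_extremal[OF assms, of r]
  have "sep_up_down \<theta> \<alpha> n r
      = 1 - iterate_kernel (partitions n) (up_down_chain \<theta> \<alpha> n) r {#n#} (replicate_mset n 1)
          / pitman \<theta> \<alpha> (replicate_mset n 1)"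
    unfolding sep_up_down_def
    by (intro max_separation_eq ge finite_partitions one_row_in_partitions
        one_column_in_partitions assms(4))
  also have "\<dots> = sep_down_up \<theta> \<alpha> (n + 1) (Suc r)"
    \<comment> \<open>The extremal density is replaced by the equal one a level higher; it remains
      to see that it is minimal there.\<close>
    unfolding sep_down_up_def extremal[symmetric]
  proof (intro max_separation_eq[symmetric])
    fix x y assume "x \<in> partitions (n + 1)" "y \<in> partitions (n + 1)"
    then show "iterate_kernel (partitions (n + 1)) (down_up_chain \<theta> \<alpha> (n + 1)) (Suc r)
          {#n + 1#} (replicate_mset (n + 1) 1) / pitman \<theta> \<alpha> (replicate_mset (n + 1) 1)
        \<le> iterate_kernel (partitions (n + 1)) (down_up_chain \<theta> \<alpha> (n + 1)) (Suc r) x y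
          / pitman \<theta> \<alpha> y"
      \<comment> \<open>Rewritten back to level \<open>n\<close>, the left-hand side is the lower
        bound \<open>m\<close> for the averaging argument.\<close>
      unfolding extremal by (intro iterate_down_up_density_ge params ge)
  qed (use one_row_in_partitions[of "n + 1"] in
      \<open>simp_all only: finite_partitions one_column_in_partitions le_add2\<close>)
  finally show ?thesis by simp
qed

end
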